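(* Let $G\in\mathcal B$ have a tight infinite cyclic subgroup $Z=\langle z\rangle$, and suppose that for each prime $p$ the $p$-torsion subgroup $T_p$ of $G$ is cyclic, say $T_p\cong\mathbb Z(p^{e_p})$ with $e_p\ge 0$. For each prime $p$ with $e_p\neq 0$, let $j_p\in\{1,2,\dots\}\cup\{\infty\}$ be the size of the single jump in the $p$-height sequence of $z$, and let $k_p\ge 1$ be such that this jump takes place between $|p^{k_p-1}z|_p$ and $|p^{k_p}z|_p$; thus, with $m_p:=|z|_p$, the $p$-height sequence of $z$ satisfies $$m_p=|z|_p<\cdots<m_p+k_p-1=|p^{k_p-1}z|_p<m_p+k_p+j_p=|p^{k_p}z|_p .$$ Then $G$ is strongly Hopfian if and only if there is an $M\in\mathbb N$ such that $e_p\le M\min\{j_p,k_p\}$ for all primes $p$ with $e_p\ne 0$.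
   Context: All groups are abelian and written additively. $\mathbb N$ denotes the positive integers; $\mathbb Z(p^e)$ is the cyclic group of order $p^e$. A group $G$ is strongly Hopfian (SH) if for every endomorphism $\phi$ of $G$ there is $n\in\mathbb N$ such that $\phi$ restricted to $\phi^n(G)$ is injective (equivalently, $\ker\phi^n=\ker\phi^m$ for all $m\ge n$). $\mathcal B$ denotes the class of all groups of torsion-free rank 1 with bounded $p$-torsion, meaning that for every prime $p$ the $p$-torsion subgroup is bounded (annihilated by some power of $p$). For $x\in G$, $|x|_p$ denotes the $p$-height of $x$ in $G$: the largest integer $k\ge 0$ with $x\in p^kG$, or $\infty$ if $x\in p^kG$ for all $k$ (in groups with bounded $p$-torsion transfinite heights need not be considered). The $p$-height sequence of $x$ is $(|x|_p,|px|_p,|p^2x|_p,\dots)$. It has a jump between $|p^{k-1}x|_p$ and $|p^kx|_p$ if $|p^{k-1}x|_p<\infty$ and $|p^kx|_p>|p^{k-1}x|_p+1$, and the size of the jump is $j=|p^kx|_p-|p^{k-1}x|_p-1$ (with $j=\infty$ if $|p^kx|_p=\infty$). For a subgroup $N\le G$, a prime $p$ and an integer $\alpha\ge 0$, the $\alpha$th $p$-Ulm factor of $N$ in $G$ is $U^p_\alpha(N)=\{x\in N:|x|_p\ge\alpha,\ |px|_p>\alpha+1\}/\{x\in N:|x|_p\ge\alpha+1\}$, with heights computed in $G$. The subgroup $N$ is tight in $G$ if the natural injection $U^p_\alpha(N)\to U^p_\alpha(G)$ is an isomorphism for all primes $p$ and all $\alpha$. (For $Z$ tight and $T_p$ nonzero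 cyclic, the $p$-height sequence of $z$ has exactly one jump.) *)

theory Defs
  imports "HOL-Algebra.Algebra" "HOL-Library.Extended_Nat"
begin

text \<open>
  Abelian groups are instances of the locale \<^locale>\<open>comm_group\<close>, whose notation is multiplicative:
  \<open>n x\<close> is rendered as \<open>x [^]\<^bsub>G\<^esub> n\<close> and \<open>p\<^sup>k G\<close> as the set of \<open>p ^ k\<close>-th powers.
\<close>

definition strongly_Hopfian :: "('a, 'b) monoid_scheme \<Rightarrow> bool" where
  "strongly_Hopfian G \<longleftrightarrow>
     (\<forall>\<phi> \<in> hom G G. \<exists>n::nat. n > 0 \<and> inj_on \<phi> ((\<phi> ^^ n) ` carrier G))"


text \<open>
  Independence over the integers; a member of an independent set automatically has infinite order,
  so the size of a maximal independent set is the torsion-free rank.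
\<close>

definition independent_in :: "('a, 'b) monoid_scheme \<Rightarrow> 'a set \<Rightarrow> bool" where
  "independent_in G S \<longleftrightarrow> S \<subseteq> carrier G \<and>
     (\<forall>F c. finite F \<longrightarrow> F \<subseteq> S \<longrightarrow>
        finprod G (\<lambda>x. x [^]\<^bsub>G\<^esub> (c x :: int)) F = \<one>\<^bsub>G\<^esub> \<longrightarrow> (\<forall>x\<in>F. c x = 0))"

definition has_torsion_free_rank :: "('a, 'b) monoid_scheme \<Rightarrow> nat \<Rightarrow> bool" where
  "has_torsion_free_rank G r \<longleftrightarrow>
     (\<exists>S. independent_in G S \<and> finite S \<and> card S = r \<and>
        (\<forall>S'. independent_in G S' \<longrightarrow> S \<subseteq> S' \<longrightarrow> S' = S))"

definition p_torsion :: "('a, 'b) monoid_scheme \<Rightarrow> nat \<Rightarrow> 'a set" where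
  "p_torsion G p = {x \<in> carrier G. \<exists>k::nat. x [^]\<^bsub>G\<^esub> (p ^ k) = \<one>\<^bsub>G\<^esub>}"

definition bounded_p_torsion :: "('a, 'b) monoid_scheme \<Rightarrow> nat \<Rightarrow> bool" where
  "bounded_p_torsion G p \<longleftrightarrow> (\<exists>k::nat. \<forall>x \<in> p_torsion G p. x [^]\<^bsub>G\<^esub> (p ^ k) = \<one>\<^bsub>G\<^esub>)"

text \<open>Unqualified \<open>prime\<close> would be the notion of primality in a monoid from HOL-Algebra.\<close>

definition class_B :: "('a, 'b) monoid_scheme \<Rightarrow> bool" where
  "class_B G \<longleftrightarrow> comm_group G \<and> has_torsion_free_rank G 1 \<and>
     (\<forall>p::nat. Factorial_Ring.prime p \<longrightarrow> bounded_p_torsion G p)"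


definition p_power :: "('a, 'b) monoid_scheme \<Rightarrow> nat \<Rightarrow> nat \<Rightarrow> 'a set" where
  "p_power G p k = (\<lambda>x. x [^]\<^bsub>G\<^esub> (p ^ k)) ` carrier G"

definition p_height :: "('a, 'b) monoid_scheme \<Rightarrow> nat \<Rightarrow> 'a \<Rightarrow> enat" where
  "p_height G p x =
     (if \<forall>k. x \<in> p_power G p k then \<infinity> else enat (GREATEST k. x \<in> p_power G p k))"

definition p_height_seq :: "('a, 'b) monoid_scheme \<Rightarrow> nat \<Rightarrow> 'a \<Rightarrow> nat \<Rightarrow> enat" where
  "p_height_seq G p x i = p_height G p (x [^]\<^bsub>G\<^esub> (p ^ i))"

text \<open>Index \<open>k\<close> denotes the jump between the heights of \<open>p\<^sup>k\<^sup>-\<^sup>1 x\<close> and \<open>p\<^sup>k x\<close>.\<close>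

definition has_jump_at :: "('a, 'b) monoid_scheme \<Rightarrow> nat \<Rightarrow> 'a \<Rightarrow> nat \<Rightarrow> bool" where
  "has_jump_at G p x k \<longleftrightarrow> k \<ge> 1 \<and> p_height_seq G p x (k - 1) < \<infinity> \<and>
     p_height_seq G p x k > p_height_seq G p x (k - 1) + 1"

text \<open>Subtraction on \<^typ>\<open>enat\<close> satisfies \<open>\<infinity> - enat n = \<infinity>\<close>, so an infinite jump has size \<open>\<infinity>\<close>.\<close>

definition jump_size :: "('a, 'b) monoid_scheme \<Rightarrow> nat \<Rightarrow> 'a \<Rightarrow> nat \<Rightarrow> enat" where
  "jump_size G p x k = p_height_seq G p x k - p_height_seq G p x (k - 1) - 1"


definition Ulm_upper :: "('a, 'b) monoid_scheme \<Rightarrow> 'a set \<Rightarrow> nat \<Rightarrow> nat \<Rightarrow> 'a set" where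
  "Ulm_upper G N p \<alpha> =
     {x \<in> N. p_height G p x \<ge> enat \<alpha> \<and> p_height G p (x [^]\<^bsub>G\<^esub> p) > enat (\<alpha> + 1)}"

definition Ulm_lower :: "('a, 'b) monoid_scheme \<Rightarrow> 'a set \<Rightarrow> nat \<Rightarrow> nat \<Rightarrow> 'a set" where
  "Ulm_lower G N p \<alpha> = {x \<in> N. p_height G p x \<ge> enat (\<alpha> + 1)}"

definition Ulm_factor :: "('a, 'b) monoid_scheme \<Rightarrow> 'a set \<Rightarrow> nat \<Rightarrow> nat \<Rightarrow> 'a set monoid" where
  "Ulm_factor G N p \<alpha> = (G\<lparr>carrier := Ulm_upper G N p \<alpha>\<rparr>) Mod (Ulm_lower G N p \<alpha>)"

text \<open>
  The natural map sends the coset of \<open>x\<close> modulo \<open>Ulm_lower G N p \<alpha>\<close> to the coset of \<open>x\<close> modulo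
  \<open>Ulm_lower G (carrier G) p \<alpha>\<close>. As the first of these subgroups is contained in the second, the
  latter coset is obtained from the former by multiplying with the larger subgroup.
\<close>

definition Ulm_map :: "('a, 'b) monoid_scheme \<Rightarrow> nat \<Rightarrow> nat \<Rightarrow> 'a set \<Rightarrow> 'a set" where
  "Ulm_map G p \<alpha> C = Ulm_lower G (carrier G) p \<alpha> <#>\<^bsub>G\<^esub> C"

definition tight :: "('a, 'b) monoid_scheme \<Rightarrow> 'a set \<Rightarrow> bool" where
  "tight G N \<longleftrightarrow> subgroup N G \<and>
     (\<forall>p \<alpha>::nat. Factorial_Ring.prime p \<longrightarrow> Ulm_map G p \<alpha> \<in> iso (Ulm_factor G N p \<alpha>) (Ulm_factor G (carrier G) p \<alpha>))"

end

theory Submission imports Defs begin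

text \<open>
  The argument is described additively, although groups are written multiplicatively below. Fix a
  prime \<open>p\<close> with \<open>e\<^sub>p > 0\<close>, let \<open>t\<close> generate \<open>T\<^sub>p\<close>, and drop the index \<open>p\<close>. A jump can only occur
  after height \<open>e - 1\<close>, so \<open>z\<close> has height \<open>e - k\<close>, and for every finite \<open>i\<close> with \<open>1 \<le> i \<le> j\<close>

    \<open>z = c p\<^bsup>e-k\<^esup> t + p\<^bsup>e-k+i\<^esup> w\<close>   for some \<open>w\<close> and some \<open>c\<close> prime to \<open>p\<close>

  (lemma \<open>decomposition\<close>). Put \<open>\<mu> = min j k\<close>. Two consequences carry the proof.

  First, an endomorphism with \<open>\<psi> z = 0\<close> multiplies \<open>T\<^sub>p\<close> by a multiple of \<open>p\<^sup>\<mu>\<close> (lemma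
  \<open>divisible_multiplier\<close>): take \<open>i = \<mu>\<close> in the displayed equation, apply \<open>\<psi>\<close>, and use that \<open>T\<^sub>p\<close> is
  pure. Given any endomorphism \<open>\<phi>\<close>, rank one yields integers \<open>a\<close> and \<open>b \<noteq> 0\<close> with \<open>b \<phi> z = a z\<close>, so
  this applies to \<open>b \<phi> - a\<close>. If \<open>a \<noteq> 0\<close>, then \<open>\<phi>\<close> is injective on \<open>T\<^sub>p\<close> for all \<open>p\<close> not dividing
  \<open>a b\<close>. If \<open>a = 0\<close>, then for all \<open>p\<close> not dividing \<open>b\<close> the multiplier on \<open>T\<^sub>p\<close> is divisible by
  \<open>p\<^sup>\<mu>\<close>, and the bound \<open>e \<le> M \<mu>\<close> makes the \<open>M\<close>-th iterate of \<open>\<phi>\<close> vanish on \<open>T\<^sub>p\<close>. In both cases the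
  kernels of the iterates stabilise uniformly on the torsion subgroup, the finitely many remaining
  primes being handled by large iterates. As either all kernels or the image of \<open>\<phi>\<close> are torsion,
  \<open>G\<close> is strongly Hopfian.

  Second, the bound is attained (lemma \<open>extremal_hom\<close>): some \<open>\<phi>\<^sub>p\<close> from \<open>G\<close> to \<open>T\<^sub>p\<close> kills \<open>z\<close> and is
  multiplication by \<open>p\<^sup>\<mu>\<close> on \<open>T\<^sub>p\<close>. If \<open>k \<le> j\<close>, then \<open>p\<^sup>k\<close> times a projection onto \<open>T\<^sub>p\<close> will do. If
  \<open>j < k\<close>, then for \<open>i = j\<close> the elements \<open>t\<close> and \<open>w\<close> form a basis of \<open>G / p\<^sup>e G\<close>, because \<open>G\<close> has rank
  one and \<open>w\<close> lies outside \<open>T\<^sub>p + p G\<close>; hence \<open>\<phi>\<^sub>p\<close> may be prescribed by \<open>t \<mapsto> p\<^sup>j t\<close> and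
  \<open>w \<mapsto> - c t\<close>. As every element has a nonzero multiple in \<open>Z\<close>, the \<open>\<phi>\<^sub>p\<close> add up to an endomorphism
  of \<open>G\<close>, which can satisfy the strongly Hopfian condition with \<open>n\<close> only if \<open>e\<^sub>p \<le> n \<mu>\<^sub>p\<close> for all \<open>p\<close>.
\<close>

section \<open>Powers in commutative groups\<close>

context comm_group begin

lemma int_pow_swap:
  "x \<in> carrier G \<Longrightarrow> (x [^] (m::int)) [^] (n::int) = (x [^] n) [^] m"
  by (simp add: int_pow_pow mult.commute)

lemma mult_inv_cancel:
  "a \<in> carrier G \<Longrightarrow> b \<in> carrier G \<Longrightarrow> a \<otimes> (b \<otimes> inv a) = b"
  by (metis inv_closed m_comm m_lcomm r_inv r_one)

lemma mult_inv_cancel3: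
  "a \<in> carrier G \<Longrightarrow> b \<in> carrier G \<Longrightarrow> c \<in> carrier G \<Longrightarrow> a \<otimes> (b \<otimes> (c \<otimes> inv a)) = b \<otimes> c"
  using mult_inv_cancel[of a "b \<otimes> c"] by (simp add: m_assoc)

lemma quotients_of_triple_eq:
  assumes "a \<in> carrier G" "b \<in> carrier G" "c \<in> carrier G"
      "a' \<in> carrier G" "b' \<in> carrier G" "c' \<in> carrier G"
    and "a \<otimes> b \<otimes> c = a' \<otimes> b' \<otimes> c'"
  shows "(a \<otimes> inv a') \<otimes> (b \<otimes> inv b') = c' \<otimes> inv c"
proof -
  have "(a \<otimes> inv a') \<otimes> (b \<otimes> inv b') = (a \<otimes> b \<otimes> c) \<otimes> inv (a' \<otimes> b') \<otimes> inv c"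
    using assms(1-6) by (simp add: inv_mult m_ac mult_inv_cancel mult_inv_cancel3)
  also have "\<dots> = c' \<otimes> inv c"
    using assms(1-6) by (simp add: assms(7) inv_mult m_ac mult_inv_cancel mult_inv_cancel3)
  finally show ?thesis .
qed

lemma pow_eq_imp_quotient_pow_eq_one:
  assumes "x \<in> carrier G" "y \<in> carrier G" "x [^] (n::int) = y [^] n"
  shows "(x \<otimes> y [^] (-1::int)) [^] n = \<one>"
  using assms by (simp add: int_pow_distrib int_pow_pow int_pow_neg int_pow_inv)

end

section \<open>Groups of torsion-free rank one\<close>

text \<open>
  The torsion-free rank is encoded by an element \<open>z\<close> of infinite order such that every group element
  has a nonzero multiple in the subgroup generated by \<open>z\<close>.
\<close>

locale rank_one_group = comm_group G for G (structure) +
  fixes z :: 'a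
  assumes z_closed [simp]: "z \<in> carrier G"
    and z_free: "\<And>n::int. z [^] n = \<one> \<Longrightarrow> n = 0"
    and rank_one: "\<And>g. g \<in> carrier G \<Longrightarrow> \<exists>(N::int) (a::int). N \<noteq> 0 \<and> g [^] N = z [^] a"
begin

definition torsion :: "'a \<Rightarrow> bool" where
  "torsion x \<longleftrightarrow> (\<exists>N::int. N \<noteq> 0 \<and> x [^] N = \<one>)"

lemma proportional_to_nontorsion:
  assumes "g \<in> carrier G" "x \<in> carrier G" "\<not> torsion x"
  shows "\<exists>(N::int) (a::int). N \<noteq> 0 \<and> g [^] N = x [^] a"
proof -
  obtain N a :: int where N: "N \<noteq> 0" "g [^] N = z [^] (a::int)" using rank_one assms by blast
  obtain M b :: int where M: "M \<noteq> 0" "x [^] M = z [^] (b::int)" using rank_one assms by blast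
  have "b \<noteq> 0" using M assms(3) by (auto simp: torsion_def)
  moreover have "g [^] (N * b) = x [^] (M * a)"
    using assms N M by (metis int_pow_pow int_pow_swap z_closed)
  ultimately show ?thesis using N M by (intro exI[of _ "N * b"] exI[of _ "M * a"]) auto
qed

end

section \<open>A cyclic primary component\<close>

text \<open>
  The torsion of \<open>G\<close> at the prime \<open>q\<close> is cyclic of order \<open>q\<^sup>e\<close> with generator \<open>t\<close>. The prime is an
  integer, as most exponents below are integers. The case \<open>e = 0\<close> is included; then \<open>t\<close> is the unit.
\<close>

locale cyclic_primary = rank_one_group +
  fixes q :: int and e :: nat and t
  assumes prime_q: "Factorial_Ring.prime q"
    and t_closed [simp]: "t \<in> carrier G"
    and primary: "\<And>x n. x \<in> carrier G \<Longrightarrow> x [^] (q ^ n) = \<one> \<Longrightarrow> \<exists>i::int. x = t [^] i"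
    and t_pow_eq_one: "\<And>i::int. t [^] i = \<one> \<longleftrightarrow> q ^ e dvd i"
begin

lemma t_pow_eq: "t [^] (i::int) = t [^] (l::int) \<longleftrightarrow> q ^ e dvd i - l"
proof -
  have "t [^] i = t [^] l \<longleftrightarrow> t [^] (i - l) = \<one>"
    by (metis (no_types, lifting) diff_add_cancel int_pow_closed int_pow_mult l_one r_cancel t_closed one_closed)
  then show ?thesis by (simp add: t_pow_eq_one)
qed

text \<open>
  The cyclic primary component is a pure subgroup.
\<close>

lemma purity:
  assumes "y \<in> carrier G" "n \<le> e" "t [^] (i::int) = y [^] (q ^ n)"
  shows "q ^ n dvd i"
proof -
  have "y [^] (q ^ (n + e)) = t [^] (i * q ^ e)"
    using assms by (metis int_pow_pow power_add t_closed)
  also have "\<dots> = \<one>" by (simp add: t_pow_eq_one)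
  finally obtain l where l: "y = t [^] (l::int)" using primary assms by blast
  then have "t [^] i = t [^] (l * q ^ n)" using assms by (simp add: int_pow_pow)
  then have "q ^ e dvd i - l * q ^ n" by (simp add: t_pow_eq)
  then have "q ^ n dvd i - l * q ^ n" using assms(2) power_le_dvd by blast
  then show ?thesis using dvd_diff_left_iff dvd_triv_right by blast
qed

text \<open>
  In additive terms, \<open>x\<close> lies in \<open>T\<^sub>q + q G\<close>, where \<open>T\<^sub>q\<close> is the component generated by \<open>t\<close>.
\<close>

definition torsion_plus_multiple :: "'a \<Rightarrow> bool" where
  "torsion_plus_multiple x \<longleftrightarrow> (\<exists>(i::int) y. y \<in> carrier G \<and> x = t [^] i \<otimes> y [^] q)"

lemma coprime_bezout:
  assumes "\<not> q dvd l"
  obtains a b :: int where "l * a + q ^ n * b = 1"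
proof -
  have "coprime l (q ^ n)"
    using assms prime_q by (metis coprime_commute coprime_power_left_iff prime_imp_coprime)
  then show ?thesis using that by (metis bezout_int coprime_iff_gcd_eq_1 mult.commute)
qed

text \<open>
  Modulo \<open>q\<^sup>n\<close>-th powers an exponent prime to \<open>q\<close> can be inverted.
\<close>

lemma divide_by_unit:
  assumes "g \<in> carrier G" "u \<in> carrier G" "y \<in> carrier G" "\<not> q dvd l"
    and eq: "g [^] l = u \<otimes> y [^] (q ^ n)"
  shows "\<exists>a y'. y' \<in> carrier G \<and> g = u [^] (a::int) \<otimes> y' [^] (q ^ n)"
proof -
  obtain a b where ab: "l * a + q ^ n * b = 1" using coprime_bezout assms by blast
  have "g = g [^] (l * a + q ^ n * b)" using ab assms by simp
  also have "\<dots> = (g [^] l) [^] a \<otimes> g [^] (q ^ n * b)"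
    using assms(1) by (simp only: int_pow_mult int_pow_pow)
  also have "\<dots> = u [^] a \<otimes> (y [^] a \<otimes> g [^] b) [^] (q ^ n)"
    unfolding eq using assms(1-3) by (simp add: int_pow_distrib int_pow_pow m_assoc mult.commute)
  finally show ?thesis using assms by (intro exI[of _ a] exI[of _ "y [^] a \<otimes> g [^] b"]) simp
qed

lemma torsion_decomposition:
  assumes "x \<in> carrier G" "torsion x"
  shows "\<exists>(i::int) y. y \<in> carrier G \<and> x = t [^] i \<otimes> y [^] (q ^ n)"
proof -
  obtain N :: int where N: "N \<noteq> 0" "x [^] N = \<one>" using assms torsion_def by blast
  obtain v N' where v: "N = N' * q ^ v" "\<not> q dvd N'"
    using multiplicity_decompose'[OF N(1), of q] prime_q
    by (metis mult.commute not_prime_unit)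
  have "(x [^] N') [^] (q ^ v) = \<one>" using N v assms by (simp add: int_pow_pow)
  then obtain i where "x [^] N' = t [^] (i::int)" using primary assms by blast
  then have "x [^] N' = t [^] i \<otimes> \<one> [^] (q ^ n)" by simp
  then obtain a y' where "y' \<in> carrier G" "x = (t [^] i) [^] (a::int) \<otimes> y' [^] (q ^ n)"
    using divide_by_unit[of x "t [^] i" \<one> N' n] assms v by auto
  then show ?thesis by (metis int_pow_pow t_closed)
qed

lemma torsion_plus_multiple_cancel:
  assumes "x \<in> carrier G" "\<not> q dvd l" "torsion_plus_multiple (x [^] l)"
  shows "torsion_plus_multiple x"
proof -
  obtain i y where "y \<in> carrier G" "x [^] l = t [^] (i::int) \<otimes> y [^] (q ^ 1)"
    using assms by (auto simp: torsion_plus_multiple_def)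
  then obtain a y' where "y' \<in> carrier G" "x = (t [^] i) [^] (a::int) \<otimes> y' [^] (q ^ 1)"
    using divide_by_unit[of x "t [^] i" y l 1] assms by auto
  then show ?thesis unfolding torsion_plus_multiple_def by (metis int_pow_pow power_one_right t_closed)
qed

text \<open>
  This is where rank one enters: modulo torsion and modulo \<open>q\<^sup>n\<close>-th powers the group is cyclic, and an
  element outside \<open>T\<^sub>q + q G\<close> generates it. Together with the next lemma, \<open>t\<close> and \<open>x\<close> form a basis of
  \<open>G / q\<^sup>e G\<close> over the integers modulo \<open>q\<^sup>e\<close>.
\<close>

lemma generation:
  assumes x: "x \<in> carrier G" "\<not> torsion_plus_multiple x" and g: "g \<in> carrier G"
  shows "\<exists>(i::int) (l::int) y. y \<in> carrier G \<and> g = t [^] i \<otimes> x [^] l \<otimes> y [^] (q ^ n)"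
proof -
  have "\<not> torsion x"
    using torsion_decomposition[of x 1] x by (auto simp: torsion_plus_multiple_def)
  then obtain N a :: int where N: "N \<noteq> 0" "g [^] N = x [^] (a::int)"
    using proportional_to_nontorsion x g by blast
  define d where "d = gcd N a"
  have d: "d \<noteq> 0" using N by (simp add: d_def)
  obtain N' A where NA: "N = N' * d" "a = A * d" "coprime N' A"
    using gcd_coprime_exists[of N a] d unfolding d_def by blast
  define u where "u = g [^] N' \<otimes> (x [^] A) [^] (-1::int)"
  have uc: "u \<in> carrier G" using x g by (simp add: u_def)
  have gu: "g [^] N' = x [^] A \<otimes> u"
    using x g by (simp add: u_def int_pow_neg m_lcomm)
  have "u [^] d = \<one>" unfolding u_def
    using x g N NA by (intro pow_eq_imp_quotient_pow_eq_one) (simp_all add: int_pow_pow)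
  then have tu: "torsion u" using d torsion_def by blast
  have nd: "\<not> q dvd N'"
  proof
    assume "q dvd N'"
    then obtain N'' where N'': "N' = N'' * q" by (metis dvd_def mult.commute)
    have "\<not> q dvd A" using NA(3) \<open>q dvd N'\<close> prime_q
      by (meson coprime_common_divisor not_prime_unit)
    have "(u [^] (-1::int)) [^] d = \<one>"
      using \<open>u [^] d = \<one>\<close> uc by (simp add: int_pow_neg int_pow_inv)
    then have "torsion (u [^] (-1::int))" using d torsion_def by blast
    then obtain i y where iy: "y \<in> carrier G" "u [^] (-1::int) = t [^] (i::int) \<otimes> y [^] (q ^ 1)"
      using torsion_decomposition[of "u [^] (-1::int)" 1] uc by auto
    have "x [^] A = (x [^] A \<otimes> u) \<otimes> u [^] (-1::int)"
      using x uc by (simp add: int_pow_neg m_assoc)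
    also have "\<dots> = (g [^] N'') [^] q \<otimes> (t [^] i \<otimes> y [^] q)"
      using g by (simp add: gu[symmetric] iy N'' int_pow_pow)
    also have "\<dots> = t [^] i \<otimes> (y \<otimes> g [^] N'') [^] q"
      using g iy by (simp add: int_pow_distrib m_ac)
    finally have "torsion_plus_multiple (x [^] A)" unfolding torsion_plus_multiple_def using g iy by blast
    then show False using torsion_plus_multiple_cancel x \<open>\<not> q dvd A\<close> by blast
  qed
  obtain i y where iy: "y \<in> carrier G" "u = t [^] (i::int) \<otimes> y [^] (q ^ n)"
    using torsion_decomposition[OF uc tu] by blast
  have "g [^] N' = t [^] i \<otimes> x [^] A \<otimes> y [^] (q ^ n)"
    using gu iy x(1) by (simp add: m_lcomm m_assoc)
  moreover have "t [^] i \<otimes> x [^] A \<in> carrier G" using x(1) by simp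
  ultimately obtain b y' where y': "y' \<in> carrier G"
     "g = (t [^] i \<otimes> x [^] A) [^] (b::int) \<otimes> y' [^] (q ^ n)"
    using divide_by_unit[OF g _ iy(1) nd] by metis
  then have "g = t [^] (i * b) \<otimes> x [^] (A * b) \<otimes> y' [^] (q ^ n)"
    using x by (simp add: int_pow_distrib int_pow_pow)
  then show ?thesis using y' by blast
qed

lemma independence:
  assumes x: "x \<in> carrier G" "\<not> torsion_plus_multiple x" and y: "y \<in> carrier G"
    and eq: "t [^] (i::int) \<otimes> x [^] (l::int) = y [^] (q ^ e)"
  shows "q ^ e dvd i \<and> q ^ e dvd l"
proof -
  have l: "q ^ e dvd l"
  proof (rule ccontr)
    assume nd: "\<not> q ^ e dvd l"
    then have "l \<noteq> 0" by auto
    then obtain v l' where v: "l = l' * q ^ v" "\<not> q dvd l'"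
      using multiplicity_decompose'[of l q] prime_q by (metis mult.commute not_prime_unit)
    have ve: "v < e" using nd v by (metis dvd_mult le_imp_power_dvd not_less)
    define s where "s = x [^] l' \<otimes> (y [^] (q ^ (e - v))) [^] (-1::int)"
    have sc: "s \<in> carrier G" using x y by (simp add: s_def)
    have "s [^] (q ^ v) = x [^] l \<otimes> (y [^] (q ^ e)) [^] (-1::int)"
      using x y ve by (simp add: s_def int_pow_distrib int_pow_pow v flip: power_add)
    also have "\<dots> = x [^] l \<otimes> (t [^] i \<otimes> x [^] l) [^] (-1::int)" by (simp add: eq)
    also have "\<dots> = t [^] (- i)"
      using x by (simp add: int_pow_neg inv_mult mult_inv_cancel)
    finally have "s [^] (q ^ (v + e)) = (t [^] (- i)) [^] (q ^ e)"
      using sc by (metis int_pow_pow power_add)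
    also have "\<dots> = \<one>" by (simp add: int_pow_pow t_pow_eq_one)
    finally obtain i' where i': "s = t [^] (i'::int)" using primary sc by blast
    have "x [^] l' = s \<otimes> y [^] (q ^ (e - v))"
      using x y by (simp add: s_def int_pow_neg m_assoc)
    also have "\<dots> = t [^] i' \<otimes> (y [^] (q ^ (e - v - 1))) [^] q"
      using y ve power_minus_mult[of "e - v" q] by (simp add: i' int_pow_pow)
    finally have "torsion_plus_multiple (x [^] l')" unfolding torsion_plus_multiple_def using y by blast
    then show False using torsion_plus_multiple_cancel x v by blast
  qed
  then obtain l' where l': "l = l' * q ^ e" by (metis dvd_def mult.commute)
  have "t [^] i = (t [^] i \<otimes> x [^] l) \<otimes> (x [^] l) [^] (-1::int)"
    using x by (simp add: int_pow_neg m_assoc)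
  also have "\<dots> = (y \<otimes> x [^] (- l')) [^] (q ^ e)"
    unfolding eq using x y by (simp add: int_pow_distrib int_pow_pow l')
  finally show ?thesis using purity[of _ e] x y l by blast
qed

text \<open>
  A homomorphism into the primary component is prescribed by its values at \<open>t\<close> and at \<open>x\<close>, as soon as
  \<open>t\<close> and \<open>x\<close> generate \<open>G / q\<^sup>e G\<close> and the values respect all relations between them there.
\<close>

lemma hom_into_primary_part:
  fixes \<alpha> \<beta> :: int
  assumes x: "x \<in> carrier G"
    and gen: "\<And>g. g \<in> carrier G \<Longrightarrow>
        \<exists>(i::int) (l::int) y. y \<in> carrier G \<and> g = t [^] i \<otimes> x [^] l \<otimes> y [^] (q ^ e)"
    and rel: "\<And>(i::int) (l::int) y. y \<in> carrier G \<Longrightarrow> t [^] i \<otimes> x [^] l = y [^] (q ^ e) \<Longrightarrow>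
        q ^ e dvd i * \<alpha> + l * \<beta>"
  shows "\<exists>\<phi> \<in> hom G G. \<phi> t = t [^] \<alpha> \<and> \<phi> x = t [^] \<beta> \<and>
    (\<forall>g \<in> carrier G. \<exists>i::int. \<phi> g = t [^] i)"
proof -
  obtain I L Y where ILY: "\<And>g. g \<in> carrier G \<Longrightarrow> Y g \<in> carrier G \<and>
     g = t [^] (I g :: int) \<otimes> x [^] (L g :: int) \<otimes> Y g [^] (q ^ e)"
    using gen by metis
  \<comment> \<open>The coordinates are chosen arbitrarily; the relations make the value independent of the choice.\<close>
  define \<phi> where "\<phi> g = t [^] (I g * \<alpha> + L g * \<beta>)" for g
  have uniq: "\<phi> g = t [^] (i * \<alpha> + l * \<beta>)"
    if y: "y \<in> carrier G" and g: "g = t [^] i \<otimes> x [^] l \<otimes> y [^] (q ^ e)" for g y and i l :: int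
  proof -
    have gc: "g \<in> carrier G" using x y g by simp
    have Y: "Y g \<in> carrier G" using ILY gc by blast
    have "t [^] I g \<otimes> x [^] L g \<otimes> Y g [^] (q ^ e) = t [^] i \<otimes> x [^] l \<otimes> y [^] (q ^ e)"
      using ILY[OF gc] g by metis
    from quotients_of_triple_eq[OF _ _ _ _ _ _ this]
    have "t [^] (I g - i) \<otimes> x [^] (L g - l) = y [^] (q ^ e) \<otimes> (Y g [^] (q ^ e)) [^] (-1::int)"
      using x y Y by (simp add: int_pow_diff int_pow_neg)
    also have "\<dots> = (y \<otimes> Y g [^] (-1::int)) [^] (q ^ e)"
      using y Y by (simp add: int_pow_distrib int_pow_swap)
    finally have "q ^ e dvd (I g - i) * \<alpha> + (L g - l) * \<beta>"
      using rel y Y by (meson int_pow_closed m_closed)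
    then show ?thesis unfolding \<phi>_def t_pow_eq by (simp add: algebra_simps)
  qed
  have "\<phi> (g \<otimes> h) = \<phi> g \<otimes> \<phi> h" if gh: "g \<in> carrier G" "h \<in> carrier G" for g h
  proof -
    have "\<phi> (g \<otimes> h) = t [^] ((I g + I h) * \<alpha> + (L g + L h) * \<beta>)"
    proof (rule uniq)
      show "Y g \<otimes> Y h \<in> carrier G" using ILY gh by simp
      have "g \<otimes> h = (t [^] I g \<otimes> x [^] L g \<otimes> Y g [^] (q ^ e)) \<otimes>
         (t [^] I h \<otimes> x [^] L h \<otimes> Y h [^] (q ^ e))"
        using ILY gh by metis
      also have "\<dots> = t [^] (I g + I h) \<otimes> x [^] (L g + L h) \<otimes> (Y g \<otimes> Y h) [^] (q ^ e)"
        using ILY[OF gh(1), THEN conjunct1] ILY[OF gh(2), THEN conjunct1] x by (simp add: int_pow_distrib int_pow_mult m_ac)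
      finally show "g \<otimes> h = t [^] (I g + I h) \<otimes> x [^] (L g + L h) \<otimes> (Y g \<otimes> Y h) [^] (q ^ e)" .
    qed
    also have "\<dots> = \<phi> g \<otimes> \<phi> h"
      unfolding \<phi>_def by (simp add: algebra_simps flip: int_pow_mult)
    finally show ?thesis .
  qed
  then have "\<phi> \<in> hom G G" by (auto simp: hom_def \<phi>_def)
  moreover have "\<phi> t = t [^] \<alpha>" using uniq[of \<one> t 1 0] x by simp
  moreover have "\<phi> x = t [^] \<beta>" using uniq[of \<one> x 0 1] x by simp
  ultimately show ?thesis by (auto simp: \<phi>_def intro!: bexI[of _ \<phi>])
qed

lemma hom_with_values:
  assumes "x \<in> carrier G" "\<not> torsion_plus_multiple x"
  shows "\<exists>\<phi> \<in> hom G G. \<phi> t = t [^] (\<alpha>::int) \<and> \<phi> x = t [^] (\<beta>::int) \<and>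
    (\<forall>g \<in> carrier G. \<exists>i::int. \<phi> g = t [^] i)"
  using assms generation independence by (intro hom_into_primary_part) (auto intro!: dvd_add dvd_mult2)

text \<open>
  The component \<open>T\<^sub>q\<close> is a direct summand; a projection is the case \<open>\<alpha> = 1\<close>.
\<close>

lemma hom_scaling_generator:
  "\<exists>\<phi> \<in> hom G G. \<phi> t = t [^] (\<alpha>::int) \<and> (\<forall>g \<in> carrier G. \<exists>i::int. \<phi> g = t [^] i)"
proof (cases "\<exists>x \<in> carrier G. \<not> torsion_plus_multiple x")
  case True
  then show ?thesis using hom_with_values by blast
next
  case False
  \<comment> \<open>Now \<open>G = T\<^sub>q + q G\<close>, so \<open>t\<close> alone generates \<open>G / q\<^sup>e G\<close> and the unit serves as second generator.\<close>
  have gen: "\<exists>(i::int) y. y \<in> carrier G \<and> g = t [^] i \<otimes> y [^] (q ^ n)" if "g \<in> carrier G" for g n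
    using that
  proof (induction n arbitrary: g)
    case 0
    then show ?case by (intro exI[of _ 0] exI[of _ g]) simp
  next
    case (Suc n)
    then obtain i y where iy: "y \<in> carrier G" "g = t [^] (i::int) \<otimes> y [^] (q ^ n)" by blast
    obtain i' y' where iy': "y' \<in> carrier G" "y = t [^] (i'::int) \<otimes> y' [^] q"
      using False iy unfolding torsion_plus_multiple_def by blast
    have "g = t [^] (i + i' * q ^ n) \<otimes> y' [^] (q ^ Suc n)"
      using iy iy' by (simp add: int_pow_distrib int_pow_pow int_pow_mult m_assoc)
    then show ?case using iy' by blast
  qed
  have "\<exists>\<phi> \<in> hom G G. \<phi> t = t [^] \<alpha> \<and> \<phi> \<one> = t [^] (0::int) \<and>
    (\<forall>g \<in> carrier G. \<exists>i::int. \<phi> g = t [^] i)"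
  proof (rule hom_into_primary_part)
    show "\<exists>(i::int) (l::int) y. y \<in> carrier G \<and> g = t [^] i \<otimes> \<one> [^] l \<otimes> y [^] (q ^ e)"
      if "g \<in> carrier G" for g
      using gen[OF that, of e] by simp
    show "q ^ e dvd i * \<alpha> + l * 0"
      if "y \<in> carrier G" "t [^] i \<otimes> \<one> [^] l = y [^] (q ^ e)" for i l :: int and y
      using purity[OF that(1), of e i] that by simp
  qed simp
  then show ?thesis by blast
qed

end

section \<open>The jump at one prime\<close>

context comm_group begin

text \<open>
  The element \<open>x\<close> has \<open>q\<close>-height at least \<open>n\<close>.
\<close>

definition pow_divisible :: "int \<Rightarrow> nat \<Rightarrow> 'a \<Rightarrow> bool" where
  "pow_divisible q n x \<longleftrightarrow> (\<exists>y \<in> carrier G. x = y [^] (q ^ n))"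

end

text \<open>
  The data of the single jump of the height sequence of \<open>z\<close>, phrased by divisibility: the height
  is at least \<open>e - k\<close> at \<open>z\<close>, less than \<open>e\<close> just before the jump, and \<open>e + j\<close> just after it.
\<close>

locale jump_primary = cyclic_primary +
  fixes k :: nat and j :: enat
  assumes k_pos: "1 \<le> k" and k_le: "k \<le> e" and j_pos: "1 \<le> j"
    and z_divisible: "pow_divisible q (e - k) z"
    and before_jump: "\<not> pow_divisible q e (z [^] (q ^ (k - 1)))"
    and after_jump: "\<And>i. enat i \<le> j \<longleftrightarrow> pow_divisible q (e + i) (z [^] (q ^ k))"
begin

text \<open>
  Additively, \<open>z = c q\<^bsup>e-k\<^esup> t + q\<^bsup>e-k+i\<^esup> w\<close> with \<open>c\<close> prime to \<open>q\<close>: up to an element of larger height,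
  \<open>z\<close> is a torsion element, and the jump happens when the multiples of that torsion element vanish.
\<close>

lemma decomposition:
  assumes i: "1 \<le> i" "enat i \<le> j"
  shows "\<exists>(c::int) w. w \<in> carrier G \<and> \<not> q dvd c \<and>
    z = t [^] (c * q ^ (e - k)) \<otimes> w [^] (q ^ (e - k + i))"
proof -
  \<comment> \<open>With \<open>z = q\<^bsup>e-k\<^esup> y\<close> and \<open>q\<^sup>k z = q\<^bsup>e+i\<^esup> w\<close>, the element \<open>y - q\<^sup>i w\<close> is annihilated by \<open>q\<^sup>e\<close>.\<close>
  obtain y where y: "y \<in> carrier G" "z = y [^] (q ^ (e - k))"
    using z_divisible by (auto simp: pow_divisible_def)
  obtain w where w: "w \<in> carrier G" "z [^] (q ^ k) = w [^] (q ^ (e + i))"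
    using after_jump i by (auto simp: pow_divisible_def)
  have "y [^] (q ^ e) = (y [^] (q ^ (e - k))) [^] (q ^ k)"
    using y(1) k_le by (simp add: int_pow_pow flip: power_add)
  also have "\<dots> = (w [^] (q ^ i)) [^] (q ^ e)"
    using w by (simp add: y(2)[symmetric] int_pow_pow power_add mult.commute)
  finally have "(y \<otimes> (w [^] (q ^ i)) [^] (-1::int)) [^] (q ^ e) = \<one>"
    using y w by (intro pow_eq_imp_quotient_pow_eq_one) auto
  then obtain c where c: "y \<otimes> (w [^] (q ^ i)) [^] (-1::int) = t [^] (c::int)"
    using primary[of "y \<otimes> (w [^] (q ^ i)) [^] (-1::int)" e] y(1) w(1) by auto
  have yc: "y = t [^] c \<otimes> w [^] (q ^ i)"
    using y(1) w by (simp add: c[symmetric] int_pow_neg m_assoc)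
  have "\<not> q dvd c"
  proof
    \<comment> \<open>Otherwise the torsion part of \<open>z\<close> would vanish one step before the jump.\<close>
    assume "q dvd c"
    then obtain c' where c': "c = c' * q" by (metis dvd_def mult.commute)
    have e1: "q ^ e = q * q ^ (e - 1)" using k_pos k_le power_minus_mult[of e q] by (simp add: mult.commute)
    have i1: "q ^ i = q * q ^ (i - 1)" using i power_minus_mult[of i q] by (simp add: mult.commute)
    have "e - k + (k - 1) = e - 1" using k_pos k_le by simp
    then have "z [^] (q ^ (k - 1)) = y [^] (q ^ (e - 1))"
      using y by (simp add: int_pow_pow flip: power_add)
    also have "\<dots> = t [^] (c' * q ^ e) \<otimes> (w [^] (q ^ (i - 1))) [^] (q ^ e)"
      unfolding yc using w by (simp add: int_pow_distrib int_pow_pow c' e1 i1 mult_ac)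
    also have "t [^] (c' * q ^ e) = \<one>" by (simp add: t_pow_eq_one)
    finally show False using before_jump w by (auto simp: pow_divisible_def)
  qed
  moreover have "z = t [^] (c * q ^ (e - k)) \<otimes> w [^] (q ^ (e - k + i))"
    unfolding y(2) yc using w by (simp add: int_pow_distrib int_pow_pow power_add mult.commute)
  ultimately show ?thesis using w by blast
qed

text \<open>
  A homomorphism that kills \<open>z\<close> multiplies \<open>T\<^sub>q\<close> by a multiple of \<open>q\<^sup>\<mu>\<close> whenever \<open>\<mu> \<le> min k j\<close>. The next
  lemma shows that this bound is attained.
\<close>

lemma divisible_multiplier:
  assumes \<mu>: "1 \<le> \<mu>" "\<mu> \<le> k" "enat \<mu> \<le> j"
    and \<psi>: "\<psi> \<in> hom G G" "\<psi> z = \<one>" "\<psi> t = t [^] (d::int)"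
  shows "q ^ \<mu> dvd d"
proof -
  interpret \<psi>: group_hom G G \<psi> using \<psi>(1) by unfold_locales
  obtain c w where w: "w \<in> carrier G" "\<not> q dvd c"
    "z = t [^] (c * q ^ (e - k)) \<otimes> w [^] (q ^ (e - k + \<mu>))"
    using decomposition \<mu> by blast
  have "\<one> = \<psi> (t [^] (c * q ^ (e - k)) \<otimes> w [^] (q ^ (e - k + \<mu>)))"
    using \<psi>(2) w(3) by simp
  also have "\<dots> = (t [^] (d * c) \<otimes> \<psi> w [^] (q ^ \<mu>)) [^] (q ^ (e - k))"
    using w(1) by (simp add: \<psi>.hom_int_pow \<psi>(3) int_pow_distrib int_pow_pow power_add mult_ac)
  finally have one: "(t [^] (d * c) \<otimes> \<psi> w [^] (q ^ \<mu>)) [^] (q ^ (e - k)) = \<one>" by simp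
  then obtain l where l: "t [^] (d * c) \<otimes> \<psi> w [^] (q ^ \<mu>) = t [^] (l::int)"
    using primary w(1) by (meson \<psi>.hom_closed int_pow_closed m_closed t_closed)
  have "q ^ e dvd l * q ^ (e - k)" using one by (simp add: l int_pow_pow t_pow_eq_one)
  moreover have "q ^ e = q ^ k * q ^ (e - k)" using k_le by (simp flip: power_add)
  ultimately have "q ^ k dvd l" using prime_q by (simp add: dvd_mult_cancel_right)
  then have dl: "q ^ \<mu> dvd l" using \<mu>(2) power_le_dvd by blast
  have "t [^] (l - d * c) = \<psi> w [^] (q ^ \<mu>)"
    unfolding int_pow_diff[OF t_closed] l[symmetric]
    using w(1) by (simp add: m_comm m_lcomm mult_inv_cancel m_assoc)
  then have "q ^ \<mu> dvd l - d * c" using purity[of "\<psi> w" \<mu>] w(1) \<mu>(2) k_le by simp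
  then have "q ^ \<mu> dvd d * c" using dl by (metis dvd_diff_right_iff)
  moreover have "coprime (q ^ \<mu>) c"
    using w(2) prime_q by (metis coprime_power_left_iff prime_imp_coprime)
  ultimately show ?thesis by (simp add: coprime_dvd_mult_left_iff)
qed

lemma extremal_hom:
  assumes \<mu>: "enat \<mu> = min j (enat k)"
  shows "\<exists>\<phi> \<in> hom G G. \<phi> t = t [^] (q ^ \<mu>) \<and> \<phi> z = \<one> \<and>
    (\<forall>g \<in> carrier G. \<exists>i::int. \<phi> g = t [^] i)"
proof (cases "enat k \<le> j")
  case True
  \<comment> \<open>Here \<open>q\<^sup>k\<close> times a projection onto \<open>T\<^sub>q\<close> works: \<open>z\<close> is divisible by \<open>q\<^bsup>e-k\<^esup>\<close> and \<open>q\<^sup>e T\<^sub>q = 0\<close>.\<close>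
  then have \<mu>k: "\<mu> = k" using \<mu> by (simp add: min_absorb2)
  obtain w where w: "w \<in> carrier G" "z = w [^] (q ^ (e - k))"
    using z_divisible by (auto simp: pow_divisible_def)
  obtain \<pi> where \<pi>: "\<pi> \<in> hom G G" "\<pi> t = t [^] (1::int)"
     "\<forall>g \<in> carrier G. \<exists>i::int. \<pi> g = t [^] i"
    using hom_scaling_generator by blast
  interpret \<pi>: group_hom G G \<pi> using \<pi>(1) by unfold_locales
  define \<phi> where "\<phi> g = \<pi> g [^] (q ^ k)" for g
  have "\<phi> \<in> hom G G" by (auto simp: hom_def \<phi>_def int_pow_distrib)
  moreover have "\<phi> t = t [^] (q ^ k)" by (simp add: \<phi>_def \<pi>(2))
  moreover have "\<forall>g \<in> carrier G. \<exists>i::int. \<phi> g = t [^] i"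
    using \<pi>(3) unfolding \<phi>_def by (metis int_pow_pow t_closed)
  moreover have "\<phi> z = \<one>"
  proof -
    obtain i where i: "\<pi> w = t [^] (i::int)" using \<pi>(3) w by blast
    have "q ^ (e - k) * q ^ k = q ^ e" using k_le by (simp flip: power_add)
    then show ?thesis unfolding \<phi>_def w(2) using w(1)
      by (simp add: \<pi>.hom_int_pow i int_pow_pow t_pow_eq_one mult.assoc)
  qed
  ultimately show ?thesis using \<mu>k by blast
next
  case False
  then have j: "j = enat \<mu>" using \<mu> by (simp add: min_def split: if_splits)
  have \<mu>1: "1 \<le> \<mu>" using j j_pos by (simp add: one_enat_def)
  obtain c w where w: "w \<in> carrier G"
    "z = t [^] (c * q ^ (e - k)) \<otimes> w [^] (q ^ (e - k + \<mu>))"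
    using decomposition \<mu>1 j by blast
  have ek: "q ^ k * q ^ (e - k) = q ^ e" using k_le by (simp flip: power_add)
  \<comment> \<open>The jump has size exactly \<open>\<mu>\<close>, so \<open>w\<close> cannot be divided further and \<open>t\<close>, \<open>w\<close> form a basis modulo
    \<open>q\<^sup>e\<close>. The value \<open>- c\<close> at \<open>w\<close> compensates for the contribution of \<open>t\<close> to \<open>z\<close>.\<close>
  have "\<not> torsion_plus_multiple w"
  proof
    assume "torsion_plus_multiple w"
    then obtain a y where y: "y \<in> carrier G" "w = t [^] (a::int) \<otimes> y [^] q"
      by (auto simp: torsion_plus_multiple_def)
    have "z [^] (q ^ k) = t [^] (c * (q ^ k * q ^ (e - k))) \<otimes>
       (t [^] (a * q ^ \<mu> * (q ^ k * q ^ (e - k))) \<otimes> y [^] ((q ^ k * q ^ (e - k)) * q ^ Suc \<mu>))"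
      unfolding w(2) using y
      by (simp add: int_pow_distrib int_pow_pow power_add mult_ac)
    also have "\<dots> = y [^] (q ^ (e + Suc \<mu>))"
      unfolding ek using y(1) by (simp add: t_pow_eq_one[THEN iffD2] power_add mult_ac)
    finally have "enat (Suc \<mu>) \<le> j"
      using y(1) after_jump unfolding pow_divisible_def by blast
    then show False by (simp add: j)
  qed
  then obtain \<phi> where \<phi>: "\<phi> \<in> hom G G" "\<phi> t = t [^] (q ^ \<mu>)" "\<phi> w = t [^] (- c)"
     "\<forall>g \<in> carrier G. \<exists>i::int. \<phi> g = t [^] i"
    using hom_with_values w(1) by blast
  interpret \<phi>: group_hom G G \<phi> using \<phi>(1) by unfold_locales
  have "\<phi> (t [^] (c * q ^ (e - k)) \<otimes> w [^] (q ^ (e - k + \<mu>))) =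
      t [^] (c * q ^ (e - k + \<mu>)) \<otimes> t [^] (- c * q ^ (e - k + \<mu>))"
    using w(1) by (simp add: \<phi>.hom_int_pow \<phi>(2,3) int_pow_pow power_add mult_ac)
  also have "\<dots> = \<one>" by (simp flip: int_pow_mult)
  finally have "\<phi> z = \<one>" using w(2) by simp
  then show ?thesis using \<phi> by blast
qed

end

section \<open>Heights and the position of the jump\<close>

context comm_group begin

lemma mem_p_power_iff: "x \<in> p_power G p n \<longleftrightarrow> pow_divisible (int p) n x"
  unfolding p_power_def pow_divisible_def by (auto simp flip: int_pow_int)

lemma pow_divisible_mono:
  assumes "pow_divisible q n x" "m \<le> n"
  shows "pow_divisible q m x"
proof -
  obtain y where y: "y \<in> carrier G" "x = y [^] (q ^ n)" using assms by (auto simp: pow_divisible_def)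
  then have "x = (y [^] (q ^ (n - m))) [^] (q ^ m)"
    using assms(2) by (simp add: int_pow_pow flip: power_add)
  then show ?thesis using y unfolding pow_divisible_def by blast
qed

lemma pow_divisible_0: "x \<in> carrier G \<Longrightarrow> pow_divisible q 0 x"
  unfolding pow_divisible_def by (auto intro: bexI[of _ x])

lemma pow_divisible_pow:
  assumes "pow_divisible q n x"
  shows "pow_divisible q (n + m) (x [^] (q ^ m))"
proof -
  obtain y where "y \<in> carrier G" "x = y [^] (q ^ n)" using assms by (auto simp: pow_divisible_def)
  then show ?thesis unfolding pow_divisible_def
    by (intro bexI[of _ y]) (simp_all add: int_pow_pow power_add)
qed

text \<open>
  The maximum in the definition of the height exists when the height is finite: the exponents \<open>n\<close> for
  which \<open>x\<close> is divisible by \<open>p\<^sup>n\<close> contain \<open>0\<close> and are closed under passing to smaller ones.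
\<close>

lemma le_p_height_iff:
  assumes "x \<in> carrier G"
  shows "enat n \<le> p_height G p x \<longleftrightarrow> pow_divisible (int p) n x"
proof (cases "\<forall>m. pow_divisible (int p) m x")
  case True
  then show ?thesis by (simp add: p_height_def mem_p_power_iff)
next
  case False
  let ?D = "\<lambda>m. pow_divisible (int p) m x"
  let ?h = "GREATEST m. ?D m"
  obtain b where b: "\<not> ?D b" using False by blast
  have bound: "m \<le> b" if "?D m" for m using that b pow_divisible_mono by (meson nat_le_linear)
  have "?D ?h" using GreatestI_nat[of ?D 0 b] bound pow_divisible_0 assms by blast
  moreover have "m \<le> ?h" if "?D m" for m using Greatest_le_nat[of ?D m b] that bound by blast
  ultimately have "?D n \<longleftrightarrow> n \<le> ?h" using pow_divisible_mono by blast
  moreover have "p_height G p x = enat ?h"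
    using False unfolding p_height_def mem_p_power_iff by (rule if_not_P)
  ultimately show ?thesis by simp
qed

lemma p_height_seq_Suc:
  assumes "x \<in> carrier G" "enat h \<le> p_height_seq G p x i"
  shows "enat (Suc h) \<le> p_height_seq G p x (Suc i)"
proof -
  have xi: "x [^] (p ^ i) \<in> carrier G" using assms(1) by simp
  have "pow_divisible (int p) h (x [^] (p ^ i))"
    using assms(2) le_p_height_iff[OF xi, of h p] by (simp add: p_height_seq_def)
  then have "pow_divisible (int p) (h + 1) ((x [^] (p ^ i)) [^] (int p ^ 1))"
    by (rule pow_divisible_pow)
  moreover have "(x [^] (p ^ i)) [^] (int p ^ 1) = x [^] (p ^ Suc i)"
    using assms(1) by (simp add: int_pow_int nat_pow_pow mult.commute)
  ultimately have "pow_divisible (int p) (Suc h) (x [^] (p ^ Suc i))" by simp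
  then show ?thesis using assms(1) by (simp add: p_height_seq_def le_p_height_iff)
qed

end

context cyclic_primary begin

text \<open>
  A jump after height \<open>h\<close> yields an element of \<open>T\<^sub>q\<close> that has order \<open>q\<^bsup>h+1\<^esup>\<close> and is not divisible by
  \<open>q\<close>. Such an element generates the cyclic group \<open>T\<^sub>q\<close>, so \<open>h = e - 1\<close>. As heights increase strictly
  while they are finite, a height sequence has at most one jump.
\<close>

lemma height_at_jump:
  assumes q: "q = int p" and x: "x \<in> carrier G" and jump: "has_jump_at G p x k"
  shows "e \<noteq> 0 \<and> p_height_seq G p x (k - 1) = enat (e - 1)"
proof -
  have k: "k \<ge> 1" using jump by (simp add: has_jump_at_def)
  obtain h where h: "p_height_seq G p x (k - 1) = enat h"
    using jump by (auto simp: has_jump_at_def)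
  have hs: "enat (h + 2) \<le> p_height_seq G p x k"
    using jump h by (cases "p_height_seq G p x k") (auto simp: has_jump_at_def one_enat_def)
  define y where "y = x [^] (q ^ (k - 1))"
  have yc: "y \<in> carrier G" using x by (simp add: y_def)
  have y_nat: "y = x [^] (p ^ (k - 1))" by (simp add: y_def q flip: int_pow_int)
  have div_y: "pow_divisible q n y \<longleftrightarrow> n \<le> h" for n
    using h le_p_height_iff[OF yc, of n p] unfolding p_height_seq_def y_nat[symmetric] q by simp
  have yq: "y [^] q = x [^] (p ^ k)"
    using x k power_minus_mult[of k q] by (simp add: y_def int_pow_pow q flip: int_pow_int)
  have "pow_divisible q (h + 2) (y [^] q)"
    using hs le_p_height_iff[of "y [^] q" "h + 2" p] yc unfolding p_height_seq_def yq[symmetric] q by simp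
  then obtain w' where w': "w' \<in> carrier G" "y [^] q = w' [^] (q ^ (h + 2))"
    by (auto simp: pow_divisible_def)
  obtain w where w: "w \<in> carrier G" "y = w [^] (q ^ h)"
    using div_y[of h] by (auto simp: pow_divisible_def)
  have "w [^] (q ^ (h + 1)) = (w' [^] q) [^] (q ^ (h + 1))"
    using w' w by (simp add: int_pow_pow mult_ac)
  then have one: "(w \<otimes> (w' [^] q) [^] (-1::int)) [^] (q ^ (h + 1)) = \<one>"
    using w w' by (intro pow_eq_imp_quotient_pow_eq_one) auto
  then obtain c where c: "w \<otimes> (w' [^] q) [^] (-1::int) = t [^] (c::int)"
    using primary w w' by (meson int_pow_closed m_closed)
  have wc: "w = t [^] c \<otimes> w' [^] q"
    using w(1) w' by (simp add: c[symmetric] int_pow_neg m_assoc)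
  have yc': "y = t [^] (c * q ^ h) \<otimes> w' [^] (q ^ (h + 1))"
    unfolding w(2) wc using w'(1) by (simp add: int_pow_distrib int_pow_pow)
  have d: "q ^ e dvd c * q ^ (h + 1)" using one unfolding c by (simp add: int_pow_pow t_pow_eq_one)
  have nd: "\<not> q ^ e dvd c * q ^ h"
  proof
    assume "q ^ e dvd c * q ^ h"
    then have "t [^] (c * q ^ h) = \<one>" by (simp add: t_pow_eq_one)
    then have "pow_divisible q (h + 1) y" unfolding yc' pow_divisible_def using w' by auto
    then show False using div_y by simp
  qed
  then have e: "e \<noteq> 0" by (metis one_dvd power_0)
  have "h < e" using nd by (metis dvd_mult le_imp_power_dvd not_less)
  moreover have "\<not> h + 1 < e"
  proof
    assume he: "h + 1 < e"
    then have "q ^ e = q ^ (e - h - 1) * q ^ (h + 1)" unfolding power_add[symmetric] by simp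
    then have "q ^ (e - h - 1) dvd c" using d prime_q by (simp add: dvd_mult_cancel_right)
    then have "q dvd c" using he by (metis dvd_power dvd_trans zero_less_diff less_diff_conv add.commute)
    then obtain c' where c': "c = c' * q" by (metis dvd_def mult.commute)
    have "y = (t [^] c' \<otimes> w') [^] (q ^ (h + 1))"
      unfolding yc' c' using w'(1) by (simp add: int_pow_distrib int_pow_pow mult_ac)
    then have "pow_divisible q (h + 1) y" unfolding pow_divisible_def using w' by auto
    then show False using div_y by simp
  qed
  ultimately have "h = e - 1" by simp
  then show ?thesis using e h by simp
qed

text \<open>
  Before the jump the heights increase by exactly one in each step, since no other jump is possible.
  Hence \<open>z\<close> itself has height \<open>e - k\<close>.
\<close>

lemma jump_primaryI:
  assumes q: "q = int p" and jump: "has_jump_at G p z k" and j: "j = jump_size G p z k"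
  shows "jump_primary G z q e t k j"
proof -
  have k: "1 \<le> k" using jump by (simp add: has_jump_at_def)
  have e: "e \<noteq> 0" and last: "p_height_seq G p z (k - 1) = enat (e - 1)"
    using height_at_jump[OF q z_closed jump] by auto
  have below: "r < k \<Longrightarrow> \<exists>h. p_height_seq G p z (k - 1 - r) = enat h \<and> h + r = e - 1" for r
  proof (induction r)
    case 0
    then show ?case using last by simp
  next
    case (Suc r)
    then obtain h where h: "p_height_seq G p z (k - 1 - r) = enat h" "h + r = e - 1" by auto
    define i where "i = k - 1 - Suc r"
    have i: "k - 1 - r = Suc i" using Suc.prems by (simp add: i_def)
    obtain g where g: "p_height_seq G p z i = enat g"
    proof (cases "p_height_seq G p z i")
      case infinity
      then have "enat (Suc h) \<le> p_height_seq G p z (Suc i)"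
        by (intro p_height_seq_Suc) simp_all
      then show ?thesis using h i by simp
    qed (use that in blast)
    have gh: "Suc g \<le> h" using p_height_seq_Suc[OF z_closed, of g p i] g h i by simp
    have "\<not> has_jump_at G p z (Suc i)"
      using height_at_jump[OF q z_closed, of "Suc i"] g gh h by auto
    then have "h = Suc g" using g gh h i by (auto simp: has_jump_at_def one_enat_def)
    then show ?case using g h i_def by auto
  qed
  obtain m where m: "p_height_seq G p z 0 = enat m" "m + (k - 1) = e - 1"
    using below[of "k - 1"] k by auto
  have q_pow: "z [^] (p ^ i) = z [^] (q ^ i)" for i by (simp add: q flip: int_pow_int)
  have div_seq: "enat n \<le> p_height_seq G p z i \<longleftrightarrow> pow_divisible q n (z [^] (q ^ i))" for n i
    unfolding p_height_seq_def q_pow unfolding q by (simp add: le_p_height_iff)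
  show ?thesis
  proof
    show "1 \<le> k" by fact
    show "k \<le> e" using m(2) e k by simp
    have "m = e - k" using m(2) e k by simp
    then show "pow_divisible q (e - k) z" using div_seq[of m 0] m by simp
    show "\<not> pow_divisible q e (z [^] (q ^ (k - 1)))"
      using div_seq[of e "k - 1"] last e by auto
    have jump': "enat (e + 1) \<le> p_height_seq G p z k"
      using jump e unfolding has_jump_at_def last
      by (cases "p_height_seq G p z k") (auto simp: one_enat_def)
    have j': "j = p_height_seq G p z k - enat e"
      using e unfolding j jump_size_def last
      by (cases "p_height_seq G p z k") (auto simp: one_enat_def)
    show "1 \<le> j" using jump' unfolding j'
      by (cases "p_height_seq G p z k") (auto simp: one_enat_def)
    show "enat i \<le> j \<longleftrightarrow> pow_divisible q (e + i) (z [^] (q ^ k))" for i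
      using jump' unfolding div_seq[symmetric] j'
      by (cases "p_height_seq G p z k") (auto simp: one_enat_def)
  qed
qed

end

section \<open>All primes together\<close>

lemma (in group) funpow_hom:
  assumes "\<phi> \<in> hom G G"
  shows "(\<phi> ^^ n) \<in> hom G G"
proof (induction n)
  case 0
  then show ?case by (simp add: hom_def)
next
  case (Suc n)
  then show ?case using assms by (auto simp: hom_def Pi_iff)
qed

text \<open>
  The torsion at every prime \<open>p\<close> is cyclic with generator \<open>t p\<close>; a jump is given only where this torsion
  is nontrivial.
\<close>

locale cyclic_primary_family = rank_one_group +
  fixes e k :: "nat \<Rightarrow> nat" and j :: "nat \<Rightarrow> enat" and t :: "nat \<Rightarrow> 'a"
  assumes cyclic: "\<And>p. Factorial_Ring.prime p \<Longrightarrow> cyclic_primary G z (int p) (e p) (t p)"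
    and jump: "\<And>p. Factorial_Ring.prime p \<Longrightarrow> e p \<noteq> 0 \<Longrightarrow>
       jump_primary G z (int p) (e p) (t p) (k p) (j p)"
begin

text \<open>
  The minimum of the jump size and the jump position; it is finite because the position is.
\<close>

definition \<mu> :: "nat \<Rightarrow> nat" where
  "\<mu> p = the_enat (min (j p) (enat (k p)))"

lemma \<mu>_eq: "enat (\<mu> p) = min (j p) (enat (k p))"
  unfolding \<mu>_def by (cases "j p") (auto simp: min_def)

lemma \<mu>_bounds:
  assumes "Factorial_Ring.prime p" "e p \<noteq> 0"
  shows "1 \<le> \<mu> p" "\<mu> p \<le> k p" "enat (\<mu> p) \<le> j p"
proof -
  interpret jump_primary G z "int p" "e p" "t p" "k p" "j p" using jump assms by blast
  have "1 \<le> enat (\<mu> p)" unfolding \<mu>_eq using j_pos k_pos by (simp add: one_enat_def)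
  then show "1 \<le> \<mu> p" by (simp add: one_enat_def)
  show "enat (\<mu> p) \<le> j p" by (simp add: \<mu>_eq)
  have "enat (\<mu> p) \<le> enat (k p)" by (simp add: \<mu>_eq)
  then show "\<mu> p \<le> k p" by simp
qed

lemma finite_prime_divisors: "a \<noteq> 0 \<Longrightarrow> finite {p::nat. int p dvd a}"
proof -
  assume "a \<noteq> 0"
  then have "finite {d. d dvd a}" by simp
  then have "finite (int -` {d. d dvd a})" by (intro finite_vimageI) (auto simp: inj_on_def)
  then show ?thesis by (simp add: vimage_def)
qed

text \<open>
  The kernels of the iterates of \<open>\<phi>\<close> are compared on torsion elements first, where finitely many primes are
  handled by taking a large iterate. Modulo torsion \<open>\<phi>\<close> is multiplication by the rational number \<open>a / b\<close>.
  If it is nonzero then all kernels are torsion, and if it is zero then the image of \<open>\<phi>\<close> is torsion.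
\<close>

lemma bounded_imp_strongly_Hopfian:
  assumes M: "\<And>p. Factorial_Ring.prime p \<Longrightarrow> e p \<noteq> 0 \<Longrightarrow> e p \<le> M * \<mu> p"
  shows "strongly_Hopfian G"
  unfolding strongly_Hopfian_def
proof
  fix \<phi> assume \<phi>: "\<phi> \<in> hom G G"
  then interpret \<phi>: group_hom G G \<phi> by unfold_locales
  have pow_hom: "(\<phi> ^^ n) \<in> hom G G" for n using funpow_hom \<phi> by blast
  have pow_closed: "(\<phi> ^^ n) x \<in> carrier G" if "x \<in> carrier G" for n x
    using pow_hom[of n] that by (auto simp: hom_def)
  have pow_int: "(\<phi> ^^ n) (x [^] i) = (\<phi> ^^ n) x [^] i" if "x \<in> carrier G" for n x and i :: int
    using hom_int_pow[OF pow_hom that] by (simp add: is_group)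
  obtain b a :: int where b: "b \<noteq> 0" and \<phi>z: "\<phi> z [^] b = z [^] a"
    using rank_one[of "\<phi> z"] by auto
  define bad where "bad = {p. int p dvd b \<or> (a \<noteq> 0 \<and> int p dvd a)}"
  have "bad \<subseteq> {p. int p dvd b} \<union> {p. a \<noteq> 0 \<and> int p dvd a}" by (auto simp: bad_def)
  moreover have "finite {p. a \<noteq> 0 \<and> int p dvd a}" using finite_prime_divisors[of a] by (cases "a = 0") auto
  ultimately have fin_bad: "finite bad" using finite_prime_divisors[OF b] finite_subset by auto
  define n0 where "n0 = M + (\<Sum>p\<in>bad. e p)"
  have e_bad: "e p \<le> n0" if "p \<in> bad" for p
    using member_le_sum[of p bad e] that fin_bad unfolding n0_def by simp
  have primary_stable: "(\<phi> ^^ n) y = \<one>"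
    if p: "Factorial_Ring.prime p" and y: "y \<in> carrier G" "y [^] (int p ^ v) = \<one>"
      and n: "n \<ge> n0" and one: "(\<phi> ^^ Suc n) y = \<one>" for p y v n
  proof -
    interpret P: cyclic_primary G z "int p" "e p" "t p" using cyclic p by blast
    obtain i where i: "y = t p [^] (i::int)" using P.primary[OF y] by blast
    have "\<phi> (t p) [^] (int p ^ e p) = \<phi> (t p [^] (int p ^ e p))" by (simp add: \<phi>.hom_int_pow)
    also have "\<dots> = \<one>" using P.t_pow_eq_one[of "int p ^ e p"] by simp
    finally obtain c where c: "\<phi> (t p) = t p [^] (c::int)"
      using P.primary[of "\<phi> (t p)" "e p"] by auto
    have powt: "(\<phi> ^^ m) (t p [^] l) = t p [^] (l * c ^ m)" for m and l :: int
      by (induction m) (simp_all add: \<phi>.hom_int_pow c int_pow_pow mult_ac)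
    have d: "int p ^ e p dvd i * c ^ Suc n"
      using one unfolding i powt P.t_pow_eq_one .
    have "int p ^ e p dvd i * c ^ n"
    proof (cases "int p dvd c")
      case False
      then have "coprime (int p ^ e p) c" using P.prime_q
        by (metis coprime_power_left_iff prime_imp_coprime)
      then show ?thesis using d
        by (metis coprime_dvd_mult_left_iff mult.assoc power_Suc2)
    next
      case True
      have "int p ^ e p dvd c ^ n"
      proof (cases "p \<in> bad \<or> e p = 0")
        case True
        then have "e p \<le> n" using e_bad n by force
        then have "int p ^ e p dvd int p ^ n" by (rule le_imp_power_dvd)
        then show ?thesis using \<open>int p dvd c\<close> dvd_power_same dvd_trans by blast
      next
        case False
        then have e: "e p \<noteq> 0" and nb: "\<not> int p dvd b" by (auto simp: bad_def)
        interpret J: jump_primary G z "int p" "e p" "t p" "k p" "j p" using jump p e by blast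
        note \<mu> = \<mu>_bounds[OF p e]
        \<comment> \<open>The combination \<open>b \<phi> - a\<close> kills \<open>z\<close>.\<close>
        define \<psi> where "\<psi> g = \<phi> g [^] b \<otimes> g [^] (- a)" for g
        have "\<psi> \<in> hom G G" by (auto simp: hom_def \<psi>_def int_pow_distrib m_ac)
        moreover have "\<psi> z = \<one>" by (simp add: \<psi>_def \<phi>z flip: int_pow_mult)
        moreover have "\<psi> (t p) = t p [^] (c * b - a)"
          by (simp add: \<psi>_def c int_pow_pow flip: int_pow_mult)
        ultimately have dm: "int p ^ \<mu> p dvd c * b - a" using J.divisible_multiplier \<mu> by blast
        have "int p dvd int p ^ \<mu> p" using \<mu>(1) by simp
        then have "int p dvd c * b - a" using dm dvd_trans by blast
        then have "int p dvd a" using \<open>int p dvd c\<close>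
          by (metis dvd_diff_right_iff dvd_mult2)
        then have "a = 0" using False by (auto simp: bad_def)
        then have "int p ^ \<mu> p dvd c * b" using dm by simp
        moreover have "coprime (int p ^ \<mu> p) b" using nb P.prime_q
          by (metis coprime_power_left_iff prime_imp_coprime)
        ultimately have "int p ^ \<mu> p dvd c" by (simp add: coprime_dvd_mult_left_iff)
        then have "(int p ^ \<mu> p) ^ n dvd c ^ n" by (rule dvd_power_same)
        moreover have "M \<le> n" using n by (simp add: n0_def)
        then have "e p \<le> \<mu> p * n"
          using order_trans[OF M[OF p e] mult_le_mono1] by (simp add: mult.commute)
        ultimately show ?thesis by (metis dvd_trans le_imp_power_dvd power_mult)
      qed
      then show ?thesis by simp
    qed
    then show ?thesis unfolding i powt P.t_pow_eq_one .
  qed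
  have torsion_stable: "(\<phi> ^^ n) y = \<one>"
    if y: "y \<in> carrier G" and tor: "torsion y" and n: "n \<ge> n0" and one: "(\<phi> ^^ Suc n) y = \<one>" for y n
  proof (rule ccontr)
    \<comment> \<open>A prime \<open>p\<close> dividing the order of the image survives in the \<open>p\<close>-primary part of \<open>y\<close>.\<close>
    define w where "w = (\<phi> ^^ n) y"
    have wc: "w \<in> carrier G" using pow_closed y by (simp add: w_def)
    assume "(\<phi> ^^ n) y \<noteq> \<one>"
    then have "ord w \<noteq> 1" using ord_eq_1[OF wc] by (simp add: w_def)
    then obtain p where p: "Factorial_Ring.prime p" "p dvd ord w" using prime_factor_nat by blast
    obtain N :: int where N: "N \<noteq> 0" "y [^] N = \<one>" using tor torsion_def by blast
    have unit: "\<not> is_unit (int p)" using p(1) not_prime_unit by auto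
    obtain v N' where v: "N = N' * int p ^ v" "\<not> int p dvd N'"
      using multiplicity_decompose'[OF N(1) unit] by (metis mult.commute)
    have "(\<phi> ^^ n) (y [^] N') = \<one>"
    proof (rule primary_stable)
      show "(y [^] N') [^] (int p ^ v) = \<one>" using N v y by (simp add: int_pow_pow)
      have "(\<phi> ^^ Suc n) (y [^] N') = (\<phi> ^^ Suc n) y [^] N'" by (rule pow_int[OF y])
      then show "(\<phi> ^^ Suc n) (y [^] N') = \<one>" unfolding one by simp
    qed (use p n y in auto)
    then have "w [^] N' = \<one>" using pow_int[OF y] by (simp add: w_def)
    then have "int (ord w) dvd N'" using int_pow_eq_id wc by blast
    then show False using p(2) v(2) by (meson dvd_trans of_nat_dvd_iff)
  qed
  have kernel_stable: "(\<phi> ^^ Suc n0) u = \<one>"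
    if u: "u \<in> carrier G" and one: "(\<phi> ^^ Suc (Suc n0)) u = \<one>" for u
  proof (cases "a = 0")
    case True
    obtain N l :: int where N: "N \<noteq> 0" "u [^] N = z [^] l" using rank_one u by blast
    have "\<phi> u [^] (N * b) = \<phi> (u [^] N) [^] b" using u by (simp add: \<phi>.hom_int_pow int_pow_pow)
    also have "\<dots> = (\<phi> z [^] b) [^] l" using N by (simp add: \<phi>.hom_int_pow int_pow_swap)
    also have "\<dots> = \<one>" using True by (simp add: \<phi>z)
    finally have "torsion (\<phi> u)" using N b unfolding torsion_def by (metis no_zero_divisors)
    then have "(\<phi> ^^ n0) (\<phi> u) = \<one>"
      using torsion_stable[of "\<phi> u" n0] u one by (simp add: funpow_swap1)
    then show ?thesis by (simp add: funpow_swap1)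
  next
    case False
    have refl: "torsion x" if x: "x \<in> carrier G" and tor: "torsion (\<phi> x)" for x
    proof -
      obtain K :: int where K: "K \<noteq> 0" "\<phi> x [^] K = \<one>" using tor torsion_def by blast
      obtain N l :: int where N: "N \<noteq> 0" "x [^] N = z [^] l" using rank_one x by blast
      have "z [^] (a * (l * K)) = (\<phi> z [^] b) [^] (l * K)" by (simp add: \<phi>z int_pow_pow)
      also have "\<dots> = \<phi> (z [^] l) [^] (b * K)" by (simp add: \<phi>.hom_int_pow int_pow_pow mult_ac)
      also have "\<dots> = (\<phi> x [^] K) [^] (N * b)" using x by (simp add: N(2)[symmetric] \<phi>.hom_int_pow int_pow_pow mult_ac)
      finally have "z [^] (a * (l * K)) = \<one>" using K by simp
      then have "l = 0" using z_free False K by fastforce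
      then show ?thesis using N by (auto simp: torsion_def)
    qed
    have "x \<in> carrier G \<Longrightarrow> torsion ((\<phi> ^^ m) x) \<Longrightarrow> torsion x" for m x
    proof (induction m)
      case (Suc m)
      then show ?case using refl[OF pow_closed[OF Suc.prems(1)], of m] by simp
    qed simp
    moreover have "torsion \<one>" unfolding torsion_def by (intro exI[of _ 1]) simp
    ultimately have "torsion u" using u one by metis
    then show ?thesis using torsion_stable[of u "Suc n0"] u one by simp
  qed
  \<comment> \<open>The iterate \<open>Suc n0\<close> leaves room for one application of \<open>\<phi>\<close> to reach the torsion subgroup.\<close>
  have "inj_on \<phi> ((\<phi> ^^ Suc n0) ` carrier G)"
  proof (rule inj_onI)
    fix y1 y2 assume "y1 \<in> (\<phi> ^^ Suc n0) ` carrier G" "y2 \<in> (\<phi> ^^ Suc n0) ` carrier G"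
      and eq: "\<phi> y1 = \<phi> y2"
    then obtain x1 x2 where x: "x1 \<in> carrier G" "x2 \<in> carrier G"
      "y1 = (\<phi> ^^ Suc n0) x1" "y2 = (\<phi> ^^ Suc n0) x2" by blast
    interpret P: group_hom G G "\<phi> ^^ Suc n0" using pow_hom by unfold_locales
    have y: "y1 \<in> carrier G" "y2 \<in> carrier G" using x pow_closed by auto
    have im: "(\<phi> ^^ Suc n0) (x1 \<otimes> inv x2) = y1 \<otimes> inv y2"
      using x by (metis P.hom_inv P.hom_mult inv_closed)
    have "(\<phi> ^^ Suc (Suc n0)) (x1 \<otimes> inv x2) = \<phi> ((\<phi> ^^ Suc n0) (x1 \<otimes> inv x2))" by simp
    also have "\<dots> = \<one>" unfolding im using y eq by simp
    finally have "y1 \<otimes> inv y2 = \<one>" using kernel_stable[of "x1 \<otimes> inv x2"] x im by simp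
    then show "y1 = y2" using y by (metis inv_closed inv_equality inv_inv)
  qed
  then show "\<exists>n::nat. n > 0 \<and> inj_on \<phi> ((\<phi> ^^ n) ` carrier G)" by blast
qed

text \<open>
  The extremal homomorphisms at all primes add up to one endomorphism \<open>\<Phi>\<close>: all of them kill \<open>z\<close>, so if
  \<open>N g\<close> is a multiple of \<open>z\<close>, then only those at primes dividing \<open>N\<close> can be nontrivial at \<open>g\<close>. As \<open>\<Phi>\<close>
  multiplies the component at \<open>r\<close> by the power of \<open>r\<close> with exponent \<open>\<mu> r\<close>, injectivity on the image of
  the \<open>n\<close>-th iterate gives \<open>e r \<le> n \<mu> r\<close>.
\<close>

lemma strongly_Hopfian_imp_bounded:
  assumes "strongly_Hopfian G"
  shows "\<exists>M \<ge> 1. \<forall>p. Factorial_Ring.prime p \<longrightarrow> e p \<noteq> 0 \<longrightarrow> e p \<le> M * \<mu> p"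
proof -
  define P where "P = {p. Factorial_Ring.prime p \<and> e p \<noteq> 0}"
  have "\<forall>p \<in> P. \<exists>\<phi>. \<phi> \<in> hom G G \<and> \<phi> (t p) = t p [^] (int p ^ \<mu> p) \<and> \<phi> z = \<one> \<and>
    (\<forall>g \<in> carrier G. \<exists>i::int. \<phi> g = t p [^] i)"
    using jump_primary.extremal_hom[OF jump \<mu>_eq] unfolding P_def by blast
  then obtain f where f: "\<And>p. p \<in> P \<Longrightarrow> f p \<in> hom G G"
      "\<And>p. p \<in> P \<Longrightarrow> f p (t p) = t p [^] (int p ^ \<mu> p)" "\<And>p. p \<in> P \<Longrightarrow> f p z = \<one>"
      "\<And>p g. p \<in> P \<Longrightarrow> g \<in> carrier G \<Longrightarrow> \<exists>i::int. f p g = t p [^] i"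
    by metis
  have fc: "f p g \<in> carrier G" if "p \<in> P" "g \<in> carrier G" for p g
    using f(1)[OF that(1)] that(2) by (auto simp: hom_def)
  have f_int: "f p (g [^] i) = f p g [^] i" if "p \<in> P" "g \<in> carrier G" for p g and i :: int
    using hom_int_pow[OF f(1)[OF that(1)] that(2)] by (simp add: is_group)
  have trivial: "f p g = \<one>" if p: "p \<in> P" and g: "g \<in> carrier G"
    and N: "f p g [^] (N::int) = \<one>" "\<not> int p dvd N" for p g N
  proof -
    interpret cyclic_primary G z "int p" "e p" "t p" using cyclic p by (simp add: P_def)
    obtain i where i: "f p g = t p [^] (i::int)" using f(4) p g by blast
    have "int p ^ e p dvd i * N" using N by (simp add: i int_pow_pow t_pow_eq_one)
    moreover have "coprime (int p ^ e p) N" using N(2) prime_q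
      by (metis coprime_power_left_iff prime_imp_coprime)
    ultimately have "int p ^ e p dvd i" by (simp add: coprime_dvd_mult_left_iff)
    then show ?thesis by (simp add: i t_pow_eq_one)
  qed
  have fin: "finite {p \<in> P. f p g \<noteq> \<one>}" if g: "g \<in> carrier G" for g
  proof -
    obtain N a :: int where N: "N \<noteq> 0" "g [^] N = z [^] a" using rank_one g by blast
    have "f p g [^] N = \<one>" if "p \<in> P" for p
      using f_int[OF that g, of N] f_int[OF that z_closed, of a] N f(3)[OF that] by simp
    then have "{p \<in> P. f p g \<noteq> \<one>} \<subseteq> {p. int p dvd N}" using trivial g by blast
    then show ?thesis using finite_prime_divisors N(1) finite_subset by blast
  qed
  define \<Phi> where "\<Phi> g = gfinprod G (\<lambda>p. f p g) P" for g
  have \<Phi>: "\<Phi> \<in> hom G G"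
  proof (rule homI)
    show "\<Phi> g \<in> carrier G" if "g \<in> carrier G" for g
      unfolding \<Phi>_def using fc that by (intro gfinprod_closed) auto
    show "\<Phi> (g \<otimes> h) = \<Phi> g \<otimes> \<Phi> h" if gh: "g \<in> carrier G" "h \<in> carrier G" for g h
    proof -
      have "\<Phi> (g \<otimes> h) = gfinprod G (\<lambda>p. f p g \<otimes> f p h) P"
        unfolding \<Phi>_def using fc gh f(1) by (intro gfinprod_cong) (auto simp: simp_implies_def hom_mult)
      also have "\<dots> = \<Phi> g \<otimes> \<Phi> h"
        unfolding \<Phi>_def using fc gh fin by (intro gfinprod_distrib) auto
      finally show ?thesis .
    qed
  qed
  obtain n where n: "n > 0" "inj_on \<Phi> ((\<Phi> ^^ n) ` carrier G)"
    using assms \<Phi> unfolding strongly_Hopfian_def by blast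
  have pow_hom: "(\<Phi> ^^ m) \<in> hom G G" for m using funpow_hom \<Phi> by blast
  have "e r \<le> n * \<mu> r" if r: "Factorial_Ring.prime r" "e r \<noteq> 0" for r
  proof -
    have rP: "r \<in> P" using r by (simp add: P_def)
    interpret R: cyclic_primary G z "int r" "e r" "t r" using cyclic r by blast
    interpret \<Phi>: group_hom G G \<Phi> using \<Phi> by unfold_locales
    have other: "f p (t r) = \<one>" if p: "p \<in> P" "p \<noteq> r" for p
    proof (rule trivial)
      have "t r [^] (int r ^ e r) = \<one>" by (simp add: R.t_pow_eq_one)
      moreover have "f p \<one> = \<one>" using f_int[OF p(1) one_closed, of 0] by simp
      ultimately show "f p (t r) [^] (int r ^ e r) = \<one>"
        using f_int[OF p(1) R.t_closed, of "int r ^ e r"] by simp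
      show "\<not> int p dvd int r ^ e r"
        using p r by (metis P_def mem_Collect_eq of_nat_dvd_iff of_nat_power prime_dvd_power primes_dvd_imp_eq)
    qed (use p in auto)
    have "\<Phi> (t r) = gfinprod G (\<lambda>p. f p (t r)) {r}"
      unfolding \<Phi>_def using rP other fc by (intro gfinprod_mono_neutral_cong_right) auto
    also have "\<dots> = f r (t r)" using fc[OF rP R.t_closed] by simp
    finally have \<Phi>t: "\<Phi> (t r) = t r [^] (int r ^ \<mu> r)" using f(2) rP by simp
    have iter: "(\<Phi> ^^ m) (t r) = t r [^] (int r ^ (m * \<mu> r))" for m
      by (induction m) (simp_all add: \<Phi>.hom_int_pow \<Phi>t int_pow_pow power_add)
    \<comment> \<open>Injectivity on the image of the \<open>n\<close>-th iterate cancels one application of \<open>\<Phi>\<close> at a time.\<close>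
    have down: "(\<Phi> ^^ (n + d)) (t r) = \<one> \<Longrightarrow> (\<Phi> ^^ n) (t r) = \<one>" for d
    proof (induction d)
      case (Suc d)
      have "(\<Phi> ^^ (n + d)) (t r) = (\<Phi> ^^ n) ((\<Phi> ^^ d) (t r))" by (simp add: funpow_add)
      moreover have "(\<Phi> ^^ d) (t r) \<in> carrier G" unfolding iter by simp
      ultimately have 1: "(\<Phi> ^^ (n + d)) (t r) \<in> (\<Phi> ^^ n) ` carrier G" by blast
      have "(\<Phi> ^^ n) \<one> = \<one>" using hom_one[OF pow_hom] by (simp add: is_group)
      then have 2: "\<one> \<in> (\<Phi> ^^ n) ` carrier G" by (metis image_eqI one_closed)
      have "\<Phi> ((\<Phi> ^^ (n + d)) (t r)) = \<Phi> \<one>" using Suc.prems by simp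
      then have "(\<Phi> ^^ (n + d)) (t r) = \<one>" using n(2) 1 2 by (meson inj_onD)
      then show ?case using Suc.IH by blast
    qed simp
    have "e r \<le> (n + e r) * \<mu> r" using \<mu>_bounds(1)[OF r]
      by (metis le_add2 mult_le_mono nat_mult_1_right)
    then have "(\<Phi> ^^ (n + e r)) (t r) = \<one>"
      unfolding iter R.t_pow_eq_one by (rule le_imp_power_dvd)
    then have "int r ^ e r dvd int r ^ (n * \<mu> r)" using down iter R.t_pow_eq_one by simp
    then have "r ^ e r dvd r ^ (n * \<mu> r)" by (simp flip: of_nat_power)
    then show ?thesis using prime_gt_1_nat[OF r(1)] by (rule power_dvd_imp_le)
  qed
  then show ?thesis using n(1) by (intro exI[of _ n]) auto
qed

lemma strongly_Hopfian_iff_bounded: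
  "strongly_Hopfian G \<longleftrightarrow> (\<exists>M\<ge>1. \<forall>p. Factorial_Ring.prime p \<longrightarrow> e p \<noteq> 0 \<longrightarrow> e p \<le> M * \<mu> p)"
  using strongly_Hopfian_imp_bounded bounded_imp_strongly_Hopfian by metis

end

section \<open>The hypotheses in terms of elements\<close>

lemma (in comm_group) independent_singleton:
  assumes "independent_in G {s}" "s [^] (n::int) = \<one>"
  shows "n = 0"
proof -
  have "s \<in> carrier G" using assms(1) by (simp add: independent_in_def)
  then have "finprod G (\<lambda>x. x [^] n) {s} = \<one>" using assms(2) by simp
  moreover have "\<forall>F c. finite F \<longrightarrow> F \<subseteq> {s} \<longrightarrow>
      finprod G (\<lambda>x. x [^] (c x :: int)) F = \<one> \<longrightarrow> (\<forall>x\<in>F. c x = 0)"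
    using assms(1) unfolding independent_in_def by (rule conjunct2)
  from this[rule_format, of "{s}" "\<lambda>_. n" s]
  have "finprod G (\<lambda>x. x [^] n) {s} = \<one> \<Longrightarrow> n = 0" by simp
  ultimately show ?thesis by blast
qed

lemma (in comm_group) rank_one_groupI:
  assumes rank: "has_torsion_free_rank G 1" and z: "z \<in> carrier G" and inf: "infinite (generate G {z})"
  shows "rank_one_group G z"
proof -
  have z_free: "n = 0" if "z [^] n = \<one>" for n :: int
  proof -
    have "ord z = 0" using inf generate_pow_card[OF z] by auto
    then show ?thesis using that int_pow_eq_id[OF z] by simp
  qed
  obtain S where S: "independent_in G S" "card S = 1"
    "\<And>S'. independent_in G S' \<Longrightarrow> S \<subseteq> S' \<Longrightarrow> S' = S"
    using rank unfolding has_torsion_free_rank_def by blast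
  then obtain s where s: "S = {s}" using card_1_singletonE by blast
  have sc: "s \<in> carrier G" using S(1) s by (simp add: independent_in_def)
  have dep: "\<exists>(N::int) (a::int). N \<noteq> 0 \<and> g [^] N = s [^] a" if g: "g \<in> carrier G" for g
  proof (cases "g = s")
    case True
    then show ?thesis by (intro exI[of _ 1]) auto
  next
    case False
    then have "\<not> independent_in G {s, g}" using S(3)[of "{s, g}"] s by auto
    then obtain F c where F: "F \<subseteq> {s, g}" "finprod G (\<lambda>x. x [^] (c x :: int)) F = \<one>" "\<exists>x \<in> F. c x \<noteq> 0"
      using sc g unfolding independent_in_def by auto
    \<comment> \<open>The relation is extended by zero coefficients to both elements.\<close>
    define c' where "c' x = (if x \<in> F then c x else 0)" for x
    have "finprod G (\<lambda>x. x [^] c' x) {s, g} = finprod G (\<lambda>x. x [^] c x) F"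
      using F(1) sc g by (intro finprod_mono_neutral_cong_right) (auto simp: c'_def)
    then have one: "s [^] c' s \<otimes> g [^] c' g = \<one>" using F(2) False sc g by simp
    have ne: "c' s \<noteq> 0 \<or> c' g \<noteq> 0" using F(1,3) by (auto simp: c'_def)
    have "c' g \<noteq> 0"
    proof
      assume "c' g = 0"
      then have "s [^] c' s = \<one>" using one sc by simp
      then show False using independent_singleton S(1) s ne \<open>c' g = 0\<close> by blast
    qed
    moreover have "g [^] c' g = s [^] (- c' s)" using one sc g
      by (metis int_pow_closed int_pow_neg inv_equality inv_inv)
    ultimately show ?thesis by blast
  qed
  show ?thesis
  proof
    show "z \<in> carrier G" by fact
    show "n = 0" if "z [^] n = \<one>" for n :: int using z_free that by blast
    show "\<exists>(N::int) (a::int). N \<noteq> 0 \<and> g [^] N = z [^] a" if g: "g \<in> carrier G" for g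
    proof -
      obtain M b :: int where M: "M \<noteq> 0" "z [^] M = s [^] b" using dep z by blast
      obtain N a :: int where N: "N \<noteq> 0" "g [^] N = s [^] a" using dep g by blast
      have "b \<noteq> 0" using M z_free by auto
      moreover have "g [^] (N * b) = z [^] (M * a)"
        using M N g z sc by (metis int_pow_pow int_pow_swap)
      ultimately show ?thesis using N(1) by (intro exI[of _ "N * b"] exI[of _ "M * a"]) auto
    qed
  qed
qed

lemma (in comm_group) subgroup_p_torsion: "subgroup (p_torsion G p) G"
proof (rule subgroupI)
  show "p_torsion G p \<subseteq> carrier G" by (auto simp: p_torsion_def)
  have "\<one> \<in> p_torsion G p" by (simp add: p_torsion_def)
  then show "p_torsion G p \<noteq> {}" by blast
  show "inv x \<in> p_torsion G p" if "x \<in> p_torsion G p" for x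
    using that by (auto simp: p_torsion_def nat_pow_inv)
  show "x \<otimes> y \<in> p_torsion G p" if xy: "x \<in> p_torsion G p" "y \<in> p_torsion G p" for x y
  proof -
    obtain m n where mn: "x \<in> carrier G" "y \<in> carrier G" "x [^] (p ^ m) = \<one>" "y [^] (p ^ n) = \<one>"
      using xy by (auto simp: p_torsion_def)
    have "x [^] (p ^ (m + n)) = (x [^] (p ^ m)) [^] (p ^ n)"
      "y [^] (p ^ (m + n)) = (y [^] (p ^ n)) [^] (p ^ m)"
      using mn(1,2) by (simp_all add: nat_pow_pow power_add mult.commute)
    then have "(x \<otimes> y) [^] (p ^ (m + n)) = \<one>"
      using mn by (simp add: nat_pow_distrib)
    then show ?thesis using mn by (auto simp: p_torsion_def)
  qed
qed

lemma (in rank_one_group) cyclic_primaryI: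
  assumes p: "Factorial_Ring.prime p"
    and iso: "G\<lparr>carrier := p_torsion G p\<rparr> \<cong> integer_mod_group (p ^ n)"
  shows "\<exists>t. cyclic_primary G z (int p) n t"
proof -
  let ?T = "G\<lparr>carrier := p_torsion G p\<rparr>" and ?Z = "integer_mod_group (p ^ n)"
  have grp: "group ?T" using subgroup_p_torsion subgroup.subgroup_is_group is_group by blast
  obtain h where h: "h \<in> iso ?T ?Z" using iso by (auto simp: is_iso_def)
  then have hom: "h \<in> hom ?T ?Z" and bij: "bij_betw h (p_torsion G p) (carrier ?Z)"
    by (auto simp: iso_def)
  have p0: "p > 0" using p prime_gt_0_nat by blast
  then have pn: "p ^ n \<noteq> 0" by simp
  have carr: "carrier ?Z = {0..<int (p ^ n)}" using pn by (simp add: carrier_integer_mod_group)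
  have "1 mod int (p ^ n) \<in> carrier ?Z" unfolding carr using p0 by simp
  then obtain t where t: "t \<in> p_torsion G p" "h t = 1 mod int (p ^ n)"
    using bij unfolding bij_betw_def by (metis imageE)
  have tc: "t \<in> carrier G" using t(1) by (simp add: p_torsion_def)
  have tp: "t [^] i \<in> p_torsion G p" for i :: int
    using subgroup_int_pow_closed[OF subgroup_p_torsion t(1)] .
  have ht: "h (t [^] i) = i mod int (p ^ n)" for i :: int
  proof -
    have "h (t [^] i) = h (t [^]\<^bsub>?T\<^esub> i)" using int_pow_consistent[OF subgroup_p_torsion t(1)] by simp
    also have "\<dots> = h t [^]\<^bsub>?Z\<^esub> i" using hom_int_pow[OF hom _ grp] t(1) by simp
    also have "\<dots> = i mod int (p ^ n)"
      unfolding int_pow_integer_mod_group t(2) by (simp add: mod_mult_right_eq)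
    finally show ?thesis .
  qed
  have inj: "inj_on h (p_torsion G p)" using bij by (simp add: bij_betw_def)
  show ?thesis
  proof (intro exI, unfold_locales)
    show "Factorial_Ring.prime (int p)" using p by simp
    show "t \<in> carrier G" by (fact tc)
    show "\<exists>i::int. x = t [^] i" if x: "x \<in> carrier G" "x [^] (int p ^ m) = \<one>" for x m
    proof -
      have "x [^] (p ^ m) = \<one>" using x(2) int_pow_int[of G x "p ^ m"] by simp
      then have xT: "x \<in> p_torsion G p" using x(1) by (auto simp: p_torsion_def)
      then have "h x \<in> carrier ?Z" using bij by (auto simp: bij_betw_def)
      then have "h (t [^] h x) = h x" unfolding ht carr by simp
      then have "x = t [^] h x" using inj xT tp by (metis inj_onD)
      then show ?thesis by blast
    qed
    show "t [^] i = \<one> \<longleftrightarrow> int p ^ n dvd i" for i :: int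
    proof -
      have "t [^] i = \<one> \<longleftrightarrow> h (t [^] i) = h (t [^] (0::int))"
        using inj tp inj_on_eq_iff by (metis int_pow_0)
      also have "\<dots> \<longleftrightarrow> int p ^ n dvd i" unfolding ht by (simp add: dvd_eq_mod_eq_0)
      finally show ?thesis .
    qed
  qed
qed

theorem proposition4p1:
  fixes G :: "('a, 'b) monoid_scheme"
    and z :: 'a
    and e k :: "nat \<Rightarrow> nat"
    and j :: "nat \<Rightarrow> enat"
  assumes "class_B G"
    and "z \<in> carrier G"
    and "infinite (generate G {z})"
    and "tight G (generate G {z})"
    and "\<And>p. Factorial_Ring.prime p \<Longrightarrow> G\<lparr>carrier := p_torsion G p\<rparr> \<cong> integer_mod_group (p ^ e p)"
    and "\<And>p. Factorial_Ring.prime p \<Longrightarrow> e p \<noteq> 0 \<Longrightarrow> has_jump_at G p z (k p)"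
    and "\<And>p. Factorial_Ring.prime p \<Longrightarrow> e p \<noteq> 0 \<Longrightarrow> j p = jump_size G p z (k p)"
  shows "strongly_Hopfian G \<longleftrightarrow>
    (\<exists>M::nat. M \<ge> 1 \<and>
       (\<forall>p. Factorial_Ring.prime p \<longrightarrow> e p \<noteq> 0 \<longrightarrow> enat (e p) \<le> enat M * min (j p) (enat (k p))))"
proof -
  interpret comm_group G using assms(1) by (simp add: class_B_def)
  interpret rank_one_group G z
    using assms(1-3) by (intro rank_one_groupI) (auto simp: class_B_def)
  have "\<forall>p. \<exists>t. Factorial_Ring.prime p \<longrightarrow> cyclic_primary G z (int p) (e p) t"
    using cyclic_primaryI assms(5) by blast
  then obtain t where t: "\<And>p. Factorial_Ring.prime p \<Longrightarrow> cyclic_primary G z (int p) (e p) (t p)"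
    by metis
  interpret cyclic_primary_family G z e k j t
  proof (intro cyclic_primary_family.intro cyclic_primary_family_axioms.intro)
    show "rank_one_group G z" by (rule rank_one_group_axioms)
    show "Factorial_Ring.prime p \<Longrightarrow> cyclic_primary G z (int p) (e p) (t p)" for p by (rule t)
    show "jump_primary G z (int p) (e p) (t p) (k p) (j p)"
      if "Factorial_Ring.prime p" "e p \<noteq> 0" for p
      using cyclic_primary.jump_primaryI[OF t refl assms(6,7)] that by blast
  qed
  have "enat (e p) \<le> enat M * min (j p) (enat (k p)) \<longleftrightarrow> e p \<le> M * \<mu> p" for M p
    unfolding \<mu>_eq[symmetric] by simp
  then show ?thesis using strongly_Hopfian_iff_bounded by simp
qed

end
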